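(* Let $\varphi \in \mathbb{Z}[X]$ be a polynomial of degree $k \geq 2$, and for a real number $P \geq 1$ and $\alpha_1, \alpha_2 \in \mathbb{R}$ set $$ f(\alpha_1, \alpha_2) = f_P(\alpha_1,\alpha_2) = \sum_{1 \leq x \leq P} e\big(\alpha_1 (\varphi(x)+x) + \alpha_2 \varphi(x)\big), $$ where $e(z) = \exp(2\pi i z)$ and the sum is over integers $x$. Then there exists a set $\mathscr{C} \subseteq \mathbb{T} = \mathbb{R}/\mathbb{Z}$ of full Lebesgue measure such that for every $\tau > 0$ there is a constant $C = C(\varphi,\tau) > 0$ with the following property: for every $\alpha_2 \in \mathscr{C}$ there exist arbitrarily large values of $P$ for which $$ \sup_{\alpha_1 \in \mathbb{T}} |f_P(\alpha_1, \alpha_2)| \geq C\, P^{3/4 - \tau}. $$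
   Context: $\mathbb{T} = \mathbb{R}/\mathbb{Z}$ is the unit torus; $f$ is $1$-periodic in each variable, so it is well defined on $\mathbb{T}^2$. The implied constant in the lower bound ($\gg$ in the paper) may depend on $\varphi$ and $\tau$ but not on $P$ or $\alpha_1,\alpha_2$. *)

theory Defs
  imports "HOL-Analysis.Analysis" "HOL-Computational_Algebra.Polynomial"
begin

text \<open>The torus \<open>\<real>/\<int>\<close> is represented by the fundamental domain \<open>[0,1)\<close>; Haar measure on
  it is then the restriction of Lebesgue measure. The exponential sum below is 1-periodic in
  both variables (\<open>expsum_periodic\<close>), so it descends to the torus.\<close>

definition torus :: "real set" where
  "torus = {0..<1}"

definition e :: "real \<Rightarrow> complex" where
  "e z = exp (2 * of_real pi * \<i> * of_real z)"

definition expsum :: "int poly \<Rightarrow> real \<Rightarrow> real \<Rightarrow> real \<Rightarrow> complex" where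
  "expsum \<phi> P \<alpha>1 \<alpha>2 =
     (\<Sum>x | 1 \<le> x \<and> real_of_int x \<le> P.
        e (\<alpha>1 * real_of_int (poly \<phi> x + x) + \<alpha>2 * real_of_int (poly \<phi> x)))"

lemma e_add_int: "e (z + real_of_int n) = e z"
proof -
  have "e (z + real_of_int n) = e z * exp (2 * of_real pi * \<i> * of_int n)"
    by (simp add: e_def distrib_left exp_add mult_ac)
  also have "exp (2 * of_real pi * \<i> * of_int n) = 1"
    using exp_integer_2pi[of "of_int n"] by (simp add: algebra_simps)
  finally show ?thesis by simp
qed

lemma norm_e [simp]: "norm (e z) = 1"
  by (simp add: e_def norm_exp_eq_Re)

lemma expsum_periodic:
  "expsum \<phi> P (\<alpha>1 + of_int m) (\<alpha>2 + of_int n) = expsum \<phi> P \<alpha>1 \<alpha>2"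
proof -
  have "e ((\<alpha>1 + of_int m) * real_of_int a + (\<alpha>2 + of_int n) * real_of_int b)
      = e (\<alpha>1 * real_of_int a + \<alpha>2 * real_of_int b)" for a b
    using e_add_int[of "\<alpha>1 * real_of_int a + \<alpha>2 * real_of_int b" "m * a + n * b"]
    by (simp add: algebra_simps)
  then show ?thesis
    unfolding expsum_def by (intro sum.cong refl) blast
qed

text \<open>On \<open>real\<close> the supremum of an unbounded set is unspecified; boundedness ensures that the
  supremum over \<open>\<alpha>1\<close> is the actual least upper bound.\<close>

lemma expsum_bdd_above: "bdd_above ((\<lambda>\<alpha>1. norm (expsum \<phi> P \<alpha>1 \<alpha>2)) ` A)"
proof (rule bdd_aboveI2)
  fix \<alpha>1
  show "norm (expsum \<phi> P \<alpha>1 \<alpha>2) \<le> real (card {x. 1 \<le> x \<and> real_of_int x \<le> P})"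
    unfolding expsum_def by (rule order_trans[OF norm_sum]) simp
qed

end

theory Submission
  imports
    Defs
    "HOL-Computational_Algebra.Squarefree"
    "HOL-Number_Theory.Cong"
    "HOL-Probability.Characteristic_Functions"
begin

text \<open>
  Put \<open>\<psi> = \<phi> + X\<close>. The phase is \<open>(\<alpha>1 + \<alpha>2) \<psi>(x) - \<alpha>2 x\<close>, so \<open>\<alpha>1\<close> may be chosen to make
  \<open>\<alpha>1 + \<alpha>2 = a/p\<close> for any \<open>a\<close>. If \<open>\<bar>\<alpha>2 - c/p\<bar> < 1/p\<^sup>2\<close> for a prime \<open>p\<close>, then for \<open>P\<close> of order \<open>p\<^sup>2\<close>
  the sum has order \<open>P/p\<close> times the complete sum \<open>S(a, c)\<close> of \<open>e((a \<psi>(x) - c x)/p)\<close> modulo \<open>p\<close>,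
  which gives \<open>P\<^bsup>3/4\<^esup>\<close> as soon as \<open>\<bar>S(a, c)\<bar>\<close> is of order \<open>p\<^bsup>1/2\<^esup>\<close>.

  The mean square of \<open>S(a, c)\<close> over \<open>a\<close> is \<open>p\<close> plus the Fourier transform at \<open>c\<close> of the numbers
  \<open>n\<^sub>h\<close> of solutions of \<open>\<psi>(x + h) = \<psi>(x)\<close> modulo \<open>p\<close>, \<open>h \<noteq> 0\<close>. Since \<open>n\<^sub>h \<le> k\<close>, Parseval's identity
  leaves at most \<open>4 k\<^sup>2\<close> numerators \<open>c\<close> without a suitable \<open>a\<close>.

  By the first Borel-Cantelli lemma almost every \<open>\<alpha>2\<close> is within \<open>1/p\<^sup>2\<close> of such an exceptional \<open>c/p\<close>
  for only finitely many \<open>p\<close>. On the other hand almost every \<open>\<alpha>2\<close> is within \<open>1/p\<^sup>2\<close> of some \<open>c/p\<close>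
  for infinitely many primes \<open>p\<close>: these events are quasi-independent, with variance of the order of
  the mean, and \<open>\<Sum> 1/p\<close> diverges.
\<close>

subsection \<open>Primes and polynomial congruences\<close>

text \<open>Erdos' argument: if the primes \<open>p \<ge> M\<close> had reciprocal sum below 1/2, more than half of the
  \<open>n \<le> N\<close> would have all prime factors below \<open>M\<close>, but writing \<open>n\<close> as a squarefree number times
  a square shows that there are at most \<open>2\<^sup>M \<surd>N\<close> of them.\<close>

lemma not_summable_inverse_primes: "\<not> summable (\<lambda>n::nat. if prime n then 1 / real n else 0)"
  (is "\<not> summable ?f")
proof
  assume "summable ?f"
  then obtain M where M: "norm (sum ?f {M..<n}) < 1/2" for n
    unfolding summable_Cauchy by (meson half_gt_zero zero_less_one order_refl)
  \<comment> \<open>The choice makes \<open>2 ^ M * K\<close> exactly half of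
    \<open>N = K\<^sup>2\<close>, which leaves the numbers with a prime factor at least
    \<open>M\<close> to fill the other half.\<close>
  define K :: nat where "K = 2 ^ (M + 1)"
  define N where "N = K\<^sup>2"
  have "K > 0" by (simp add: K_def)
  then have "N > 0" by (simp add: N_def)
  define Sm where "Sm = {n \<in> {1..N}. \<forall>p. prime p \<longrightarrow> p dvd n \<longrightarrow> p < M}"
  define Rg where "Rg = {n \<in> {1..N}. \<exists>p. prime p \<and> p dvd n \<and> p \<ge> M}"
  define Pr where "Pr = {p \<in> {M..<Suc N}. prime p}"
  \<comment> \<open>For \<open>n\<close> in \<open>Sm\<close> the primes of odd multiplicity all lie
    below \<open>M\<close> and determine the squarefree part, so the pair recovers
    \<open>n\<close>.\<close>
  let ?g = "\<lambda>n. ({p \<in> {..<M}. prime p \<and> odd (multiplicity p n)}, square_part n)"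
  have "inj_on ?g Sm"
  proof (rule inj_onI)
    fix m n assume m: "m \<in> Sm" and n: "n \<in> Sm" and eq: "?g m = ?g n"
    have mult: "multiplicity p (squarefree_part m) = multiplicity p (squarefree_part n)"
      if p: "prime p" for p
    proof (cases "p < M")
      case True
      with eq p have "odd (multiplicity p m) = odd (multiplicity p n)" by auto
      then show ?thesis using p m n
        by (auto simp: Sm_def prime_multiplicity_squarefree_part mod2_eq_if)
    next
      case False
      then have "\<not> p dvd m" "\<not> p dvd n" using p m n by (auto simp: Sm_def)
      then show ?thesis using p m n
        by (auto simp: Sm_def prime_multiplicity_squarefree_part not_dvd_imp_multiplicity_0)
    qed
    have "squarefree_part m = squarefree_part n"
    proof (rule multiplicity_eq_nat)
      show "squarefree_part m > 0" "squarefree_part n > 0"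
        by (metis gr0I squarefree_part_nonzero)+
    qed (rule mult)
    moreover have "square_part m = square_part n" using eq by simp
    ultimately show "m = n" by (metis squarefree_decompose)
  qed
  moreover have "?g ` Sm \<subseteq> Pow {..<M} \<times> {1..K}"
  proof -
    have "square_part n \<in> {1..K}" if "n \<in> Sm" for n
    proof -
      have n: "n > 0" "n \<le> N" using that by (auto simp: Sm_def)
      have "square_part n ^ 2 \<le> n" using n by (intro dvd_imp_le) auto
      also have "n \<le> K\<^sup>2" using n(2) by (simp add: N_def)
      finally have "square_part n ^ 2 \<le> K\<^sup>2" .
      then have "square_part n \<le> K" using power2_nat_le_eq_le by blast
      moreover
      have "square_part n \<noteq> 0" using n(1) by (subst square_part_0_iff) simp
      then have "1 \<le> square_part n" by linarith
      ultimately show ?thesis by simp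
    qed
    then show ?thesis by auto
  qed
  ultimately have "card Sm \<le> card (Pow {..<M} \<times> {1..K})"
    by (intro card_inj_on_le) auto
  then have Sm: "card Sm \<le> 2 ^ M * K" by (simp add: card_cartesian_product card_Pow)
  have "card Rg \<le> card (\<Union>p\<in>Pr. {n \<in> {1..N}. p dvd n})"
  proof (intro card_mono subsetI)
    fix n assume "n \<in> Rg"
    then obtain p where p: "n \<in> {1..N}" "prime p" "p dvd n" "p \<ge> M" by (auto simp: Rg_def)
    then have "p \<le> n" by (intro dvd_imp_le) auto
    with p have "p \<in> Pr" by (auto simp: Pr_def)
    with p show "n \<in> (\<Union>p\<in>Pr. {n \<in> {1..N}. p dvd n})" by auto
  qed (simp add: Pr_def)
  also have "\<dots> \<le> (\<Sum>p\<in>Pr. card {n \<in> {1..N}. p dvd n})"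
    by (intro card_UN_le) (simp add: Pr_def)
  finally have "real (card Rg) \<le> (\<Sum>p\<in>Pr. real (card {n \<in> {1..N}. p dvd n}))"
    by (metis of_nat_le_iff of_nat_sum)
  also have "\<dots> \<le> (\<Sum>p\<in>Pr. real N * (1 / real p))"
  proof (intro sum_mono)
    fix p assume "p \<in> Pr"
    then have p: "p > 0" by (auto simp: Pr_def prime_gt_0_nat)
    have "{n \<in> {1..N}. p dvd n} \<subseteq> (\<lambda>j. p * j) ` {1..N div p}"
    proof
      fix n assume "n \<in> {n \<in> {1..N}. p dvd n}"
      then have "n \<ge> 1" "n \<le> N" "p dvd n" by auto
      then obtain j where j: "n = p * j" by (auto elim: dvdE)
      have "j \<le> N div p" using j \<open>n \<le> N\<close> p by (simp add: less_eq_div_iff_mult_less_eq mult.commute)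
      moreover have "j \<ge> 1" using \<open>n \<ge> 1\<close> j by (cases j) auto
      ultimately show "n \<in> (\<lambda>j. p * j) ` {1..N div p}" using j by auto
    qed
    then have "card {n \<in> {1..N}. p dvd n} \<le> card {1..N div p}"
      by (rule surj_card_le[rotated]) simp
    then have "real (card {n \<in> {1..N}. p dvd n}) \<le> real (N div p)" by simp
    also have "\<dots> \<le> real N / real p" by (rule of_nat_div_le_of_nat)
    finally show "real (card {n \<in> {1..N}. p dvd n}) \<le> real N * (1 / real p)" by simp
  qed
  also have "\<dots> = real N * sum ?f {M..<Suc N}"
    unfolding sum_distrib_left[symmetric] Pr_def by (subst sum.inter_filter) simp_all
  also have "\<dots> < real N * (1/2)"
    using M[of "Suc N"] \<open>N > 0\<close> by (intro mult_strict_left_mono) auto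
  finally have Rg: "real (card Rg) < real N / 2" by simp
  have "{1..N} = Sm \<union> Rg" by (auto simp: Sm_def Rg_def not_less)
  then have "card {1..N} \<le> card Sm + card Rg" by (simp only: card_Un_le)
  then have "N \<le> card Sm + card Rg" by simp
  with Sm have "N \<le> 2 ^ M * K + card Rg" by linarith
  then have "real N \<le> real (2 ^ M * K + card Rg)" by (simp only: of_nat_le_iff)
  then have "real N \<le> 2 ^ M * real K + real (card Rg)" by simp
  moreover have "real N / 2 = 2 ^ M * real K" by (simp add: N_def K_def power2_eq_square)
  ultimately show False using Rg by linarith
qed

text \<open>Lagrange's theorem by induction on the degree: split off \<open>X - a\<close> at a root
  \<open>a\<close> modulo \<open>p\<close>. The remainder \<open>poly f a\<close> is divisible by
  \<open>p\<close>, so the quotient keeps a coefficient prime to \<open>p\<close>, and since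
  \<open>p\<close> is prime every root other than \<open>a\<close> is a root of the quotient. Any
  coefficient may witness nonvanishing, as the leading one of a difference polynomial is not under
  control.\<close>

lemma card_roots_mod_prime_le:
  fixes f :: "int poly"
  assumes "prime p" and "\<not> p dvd coeff f i"
  shows "card {x \<in> {0..<p}. p dvd poly f x} \<le> degree f"
  using assms(2)
proof (induction "degree f" arbitrary: f i)
  case 0
  then obtain c where "f = [:c:]" by (metis degree_eq_zeroE)
  with 0 have "{x \<in> {0..<p}. p dvd poly f x} = {}" by (cases i) auto
  then show ?case by (metis card.empty le0)
next
  case (Suc n)
  show ?case
  proof (cases "\<exists>a\<in>{0..<p}. p dvd poly f a")
    case False
    then have "{x \<in> {0..<p}. p dvd poly f x} = {}" by auto
    then show ?thesis by (metis card.empty le0)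
  next
    case True
    then obtain a where a: "a \<in> {0..<p}" "p dvd poly f a" by auto
    define g where "g = synthetic_div f a"
    have f: "f = [:-a, 1:] * g + [:poly f a:]"
      unfolding g_def by (rule synthetic_div_correct'[symmetric])
    have deg: "degree g = n" using Suc(2) by (simp add: g_def degree_synthetic_div)
    have "\<exists>j. \<not> p dvd coeff g j"
    proof (rule ccontr)
      assume "\<nexists>j. \<not> p dvd coeff g j"
      then have "p dvd coeff ([:-a, 1:] * g + [:poly f a:]) i"
        using a(2) by (cases i) (auto simp: coeff_pCons)
      with Suc.prems f show False by metis
    qed
    then obtain j where "\<not> p dvd coeff g j" by auto
    then have IH: "card {x \<in> {0..<p}. p dvd poly g x} \<le> n"
      using Suc(1)[of g j] deg by simp
    have fin: "finite {x \<in> {0..<p}. p dvd poly g x}"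
      by (rule finite_subset[of _ "{0..<p}"]) auto
    have "{x \<in> {0..<p}. p dvd poly f x} \<subseteq> insert a {x \<in> {0..<p}. p dvd poly g x}"
    proof
      fix x assume "x \<in> {x \<in> {0..<p}. p dvd poly f x}"
      then have x: "x \<in> {0..<p}" "p dvd poly f x" by auto
      have "poly f x = (x - a) * poly g x + poly f a"
        by (subst f) (simp add: algebra_simps)
      with x a have "p dvd (x - a) * poly g x" by (metis dvd_add_left_iff)
      then have "p dvd x - a \<or> p dvd poly g x" using assms(1) prime_dvd_mult_iff by blast
      moreover have "x = a" if "p dvd x - a"
        using that x(1) a(1) by (auto dest: mod_eq_dvd_iff[THEN iffD2] simp: mod_pos_pos_trivial)
      ultimately show "x \<in> insert a {x \<in> {0..<p}. p dvd poly g x}" using x by auto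
    qed
    then have "card {x \<in> {0..<p}. p dvd poly f x} \<le> card (insert a {x \<in> {0..<p}. p dvd poly g x})"
      by (intro card_mono finite.insertI fin)
    also have "\<dots> \<le> Suc (card {x \<in> {0..<p}. p dvd poly g x})"
      using fin by (simp only: card_insert_if) simp
    also have "\<dots> \<le> Suc n" using IH by simp
    finally show ?thesis using Suc(2) by simp
  qed
qed

lemma diff_dvd_poly_diff:
  fixes f :: "'a::comm_ring_1 poly"
  shows "x - y dvd poly f x - poly f y"
proof (induction f)
  case (pCons a f)
  have "poly (pCons a f) x - poly (pCons a f) y = x * (poly f x - poly f y) + (x - y) * poly f y"
    by (simp add: algebra_simps)
  with pCons show ?case by (metis dvd_add dvd_mult dvd_triv_left)
qed simp

text \<open>The collisions are the roots modulo \<open>p\<close> of the difference polynomial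
  \<open>D\<close>, so Lagrange's bound applies once \<open>D\<close> does not vanish identically
  modulo \<open>p\<close>.\<close>

lemma card_shift_collisions_le:
  fixes \<psi> :: "int poly"
  assumes p: "prime p" and lc: "\<not> p dvd lead_coeff \<psi>" and deg: "degree \<psi> > 0" "int (degree \<psi>) < p"
    and h: "\<not> p dvd h"
  shows "card {x \<in> {0..<p}. p dvd poly \<psi> (x + h) - poly \<psi> x} \<le> degree \<psi>"
proof -
  define D where "D = pcompose \<psi> [:h, 1:] - \<psi>"
  have D: "poly D x = poly \<psi> (x + h) - poly \<psi> x" for x
    by (simp add: D_def poly_pcompose add.commute)
  have "degree D \<le> degree \<psi>"
    unfolding D_def by (intro degree_diff_le) (auto simp: degree_pcompose)
  moreover have "\<exists>i. \<not> p dvd coeff D i"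
    \<comment> \<open>otherwise \<open>\<psi>\<close> has period \<open>h\<close>, hence is constant modulo \<open>p\<close>, with too many roots of \<open>\<psi> - \<psi>(0)\<close>\<close>
  proof (rule ccontr)
    assume "\<nexists>i. \<not> p dvd coeff D i"
    then have "p dvd poly D x" for x
      by (simp add: poly_altdef dvd_sum)
    then have step: "p dvd poly \<psi> (x + h) - poly \<psi> x" for x using D by simp
    have mult: "p dvd poly \<psi> (int n * h) - poly \<psi> 0" for n
    proof (induction n)
      case (Suc n)
      have "poly \<psi> (int (Suc n) * h) - poly \<psi> 0
          = (poly \<psi> (int n * h + h) - poly \<psi> (int n * h)) + (poly \<psi> (int n * h) - poly \<psi> 0)"
        by (simp add: algebra_simps)
      then show ?case using step Suc by (metis dvd_add)
    qed simp
    have "p dvd poly \<psi> x - poly \<psi> 0" for x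
    proof -
      have "coprime h p" using p h by (metis prime_imp_coprime coprime_commute)
      then obtain g where g: "[h * g = 1] (mod p)" using cong_solve_coprime_int by blast
      \<comment> \<open>Since \<open>g\<close> inverts \<open>h\<close> modulo \<open>p\<close>,
        \<open>n\<close> shifts by \<open>h\<close> lead from 0 to \<open>x\<close> modulo
        \<open>p\<close>. Taking the residue makes \<open>n\<close> a natural number, as
        \<open>mult\<close> requires.\<close>
      define n where "n = nat ((x * g) mod p)"
      have "p > 0" using p prime_gt_0_int by blast
      then have "[int n = x * g] (mod p)" by (simp add: n_def cong_def)
      then have "[int n * h = x * (h * g)] (mod p)" by (metis cong_scalar_right mult.assoc mult.commute)
      also have "[x * (h * g) = x * 1] (mod p)" using g cong_scalar_left by blast
      finally have "p dvd int n * h - x" by (simp add: cong_iff_dvd_diff)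
      then have "p dvd poly \<psi> (int n * h) - poly \<psi> x" by (metis dvd_trans diff_dvd_poly_diff)
      from dvd_diff[OF mult[of n] this] show ?thesis by simp
    qed
    then have "{x \<in> {0..<p}. p dvd poly (\<psi> - [:poly \<psi> 0:]) x} = {0..<p}" by auto
    \<comment> \<open>Positive degree keeps the subtracted constant away from the leading
      coefficient, so Lagrange's bound applies: \<open>p\<close> roots against at most
      \<open>degree \<psi> < p\<close>.\<close>
    moreover have "coeff (\<psi> - [:poly \<psi> 0:]) (degree \<psi>) = lead_coeff \<psi>"
      using deg(1) by (cases "degree \<psi>") auto
    then have "card {x \<in> {0..<p}. p dvd poly (\<psi> - [:poly \<psi> 0:]) x} \<le> degree (\<psi> - [:poly \<psi> 0:])"
      using p lc by (intro card_roots_mod_prime_le[of _ _ "degree \<psi>"]) auto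
    moreover have "degree (\<psi> - [:poly \<psi> 0:]) \<le> degree \<psi>"
      by (intro degree_diff_le) auto
    ultimately show False using deg by simp
  qed
  ultimately show ?thesis
    using card_roots_mod_prime_le[OF p] unfolding D[symmetric] by (meson order_trans)
qed

subsection \<open>Complete exponential sums modulo a prime\<close>

lemma e_0 [simp]: "e 0 = 1"
  by (simp add: e_def)

lemma e_add: "e (x + y) = e x * e y"
  by (simp add: e_def distrib_left exp_add)

lemma e_uminus: "e (- x) = cnj (e x)"
  by (simp add: e_def exp_cnj)

lemma e_diff: "e (x - y) = e x * cnj (e y)"
  using e_add[of x "- y"] by (simp add: e_uminus)

lemma e_eq_1_imp: "e x = 1 \<Longrightarrow> x \<in> \<int>"
proof -
  assume "e x = 1"
  then obtain n :: int where "2 * pi * x = of_int n * (2 * pi)"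
    unfolding e_def exp_eq_1 by auto
  then have "x = of_int n" by simp
  then show ?thesis by simp
qed

lemma norm_e_diff_1_le: "norm (e x - 1) \<le> 2 * pi * \<bar>x\<bar>"
proof -
  have "e x = iexp (2 * pi * x)" by (simp add: e_def mult_ac)
  then show ?thesis using iexp_approx1[of "2 * pi * x" 0] by (simp add: abs_mult)
qed

lemma e_cong:
  assumes "p > 0" "p dvd m - n"
  shows "e (of_int m / of_int p) = e (of_int n / of_int p)"
proof -
  obtain j where j: "m - n = p * j" using assms(2) by (elim dvdE)
  have "of_int m / of_int p = of_int n / of_int p + real_of_int j"
  proof -
    have "m = n + p * j" using j by simp
    then show ?thesis using assms(1) by (simp add: field_simps)
  qed
  then show ?thesis by (simp add: e_add_int)
qed

lemma periodic_add_mult: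
  fixes f :: "int \<Rightarrow> 'a"
  assumes per: "\<And>x. f (x + p) = f x"
  shows "f (x + p * int n) = f x"
proof (induction n)
  case (Suc n)
  have "x + p * int (Suc n) = (x + p * int n) + p" by (simp add: algebra_simps)
  then show ?case using Suc per by metis
qed simp

lemma sum_periodic_shift:
  fixes f :: "int \<Rightarrow> 'a::comm_monoid_add"
  assumes per: "\<And>x. f (x + p) = f x" and p: "p > 0"
  shows "(\<Sum>x\<in>{0..<p}. f (x + h)) = (\<Sum>x\<in>{0..<p}. f x)"
proof -
  have perm: "f (x + p * int n) = f x" for x n
    by (rule periodic_add_mult[of f, OF per])
  have modf: "f x = f (x mod p)" for x
  \<comment> \<open>The fact \<open>perm\<close> adds natural multiples of \<open>p\<close> only;
    for a negative quotient it is applied upwards, from \<open>x\<close> to its residue.\<close>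
  proof (cases "x div p \<ge> 0")
    case True
    then show ?thesis using perm[of "x mod p" "nat (x div p)"] by simp
  next
    case False
    then have "x mod p = x + p * int (nat (- (x div p)))"
      by (simp add: minus_div_mult_eq_mod[symmetric] algebra_simps)
    then show ?thesis using perm[of x] by metis
  qed
  have "(\<Sum>x\<in>{0..<p}. f (x + h)) = (\<Sum>x\<in>{0..<p}. f ((x + h) mod p))"
    by (intro sum.cong refl modf)
  also have "\<dots> = (\<Sum>x\<in>{0..<p}. f x)"
  proof (rule sum.reindex_bij_witness[of _ "\<lambda>x. (x - h) mod p" "\<lambda>x. (x + h) mod p"])
  qed (use p in \<open>auto simp: mod_simps\<close>)
  finally show ?thesis .
qed

text \<open>Shifting \<open>a\<close> by 1 permutes the residues but multiplies the sum by
  \<open>e(m/p)\<close>, which differs from 1 unless \<open>p\<close> divides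
  \<open>m\<close>.\<close>

lemma sum_e_orthogonal:
  assumes "p > 0"
  shows "(\<Sum>a\<in>{0..<p}. e (of_int (a * m) / of_int p)) = (if p dvd m then of_int p else 0)"
proof (cases "p dvd m")
  case True
  have "e (of_int (a * m) / of_int p) = 1" for a
    using e_cong[of p "a * m" 0] assms True by simp
  then show ?thesis using True assms by simp
next
  case False
  let ?f = "\<lambda>a. e (of_int (a * m) / of_int p)"
  let ?w = "e (of_int m / of_int p)"
  have "(\<Sum>a\<in>{0..<p}. ?f a) = (\<Sum>a\<in>{0..<p}. ?f (a + 1))"
    by (intro sum_periodic_shift[symmetric] e_cong assms) (simp_all add: algebra_simps assms)
  also have "\<dots> = ?w * (\<Sum>a\<in>{0..<p}. ?f a)"
    unfolding sum_distrib_left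
    by (intro sum.cong refl) (simp add: e_add[symmetric] add_divide_distrib algebra_simps)
  finally have "(1 - ?w) * (\<Sum>a\<in>{0..<p}. ?f a) = 0" by (simp add: algebra_simps)
  moreover have "?w \<noteq> 1"
  proof
    assume "?w = 1"
    then obtain j where "real_of_int m / real_of_int p = of_int j"
      using e_eq_1_imp Ints_cases by metis
    then have "real_of_int m = of_int (p * j)" using assms by (simp add: field_simps)
    then have "m = p * j" using of_int_eq_iff by blast
    with False show False by simp
  qed
  ultimately show ?thesis using False by simp
qed

section \<open>Mean squares of complete sums and exceptional numerators\<close>

definition complete_sum :: "int poly \<Rightarrow> int \<Rightarrow> int \<Rightarrow> int \<Rightarrow> complex" where
  "complete_sum \<psi> p a c = (\<Sum>x\<in>{0..<p}. e (of_int (a * poly \<psi> x - c * x) / of_int p))"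

definition shift_collisions :: "int poly \<Rightarrow> int \<Rightarrow> int \<Rightarrow> nat" where
  "shift_collisions \<psi> p h = card {x \<in> {0..<p}. p dvd poly \<psi> (x + h) - poly \<psi> x}"

lemma e_poly_phase_periodic:
  assumes "p > 0"
  shows "e (of_int (a * poly \<psi> (x + p) - c * (x + p)) / of_int p)
       = e (of_int (a * poly \<psi> x - c * x) / of_int p)"
proof (rule e_cong)
  have "p dvd poly \<psi> (x + p) - poly \<psi> x"
    using diff_dvd_poly_diff[of "x + p" x \<psi>] by simp
  then have "p dvd a * (poly \<psi> (x + p) - poly \<psi> x) - c * p" by simp
  then show "p dvd a * poly \<psi> (x + p) - c * (x + p) - (a * poly \<psi> x - c * x)"
    by (simp add: algebra_simps)
qed (fact assms)

text \<open>Expand the square as a double sum over \<open>x\<close> and \<open>y = x + h\<close>; by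
  periodicity \<open>h\<close> may run over a full period for each \<open>x\<close>. The linear part
  of the phase then contributes only \<open>e(-c h/p)\<close>, which is free of both
  \<open>a\<close> and \<open>x\<close>.\<close>

lemma complete_sum_norm_sq:
  assumes p: "p > 0"
  shows "of_real ((norm (complete_sum \<psi> p a c))\<^sup>2) =
    (\<Sum>h\<in>{0..<p}. \<Sum>x\<in>{0..<p}. e (of_int (a * (poly \<psi> (x + h) - poly \<psi> x)) / of_int p)
                                * e (of_int (- c * h) / of_int p))"
proof -
  define t where "t x = e (of_int (a * poly \<psi> x - c * x) / of_int p)" for x
  have per: "t (x + p) = t x" for x
    unfolding t_def using e_poly_phase_periodic[OF p] .
  have "of_real ((norm (complete_sum \<psi> p a c))\<^sup>2) = (\<Sum>y\<in>{0..<p}. t y) * cnj (\<Sum>x\<in>{0..<p}. t x)"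
    unfolding complex_norm_square complete_sum_def t_def ..
  also have "\<dots> = (\<Sum>x\<in>{0..<p}. (\<Sum>y\<in>{0..<p}. t y) * cnj (t x))"
    by (simp add: sum_distrib_left)
  also have "\<dots> = (\<Sum>x\<in>{0..<p}. (\<Sum>h\<in>{0..<p}. t (h + x)) * cnj (t x))"
    using sum_periodic_shift[of t p, OF per p] by simp
  also have "\<dots> = (\<Sum>x\<in>{0..<p}. \<Sum>h\<in>{0..<p}. t (x + h) * cnj (t x))"
    by (simp add: sum_distrib_right add.commute)
  also have "\<dots> = (\<Sum>h\<in>{0..<p}. \<Sum>x\<in>{0..<p}. t (x + h) * cnj (t x))"
    by (rule sum.swap)
  also have "\<dots> = (\<Sum>h\<in>{0..<p}. \<Sum>x\<in>{0..<p}. e (of_int (a * (poly \<psi> (x + h) - poly \<psi> x)) / of_int p)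
      * e (of_int (- c * h) / of_int p))"
    unfolding t_def e_diff[symmetric] e_add[symmetric]
    by (intro sum.cong refl arg_cong[of _ _ e])
      (simp add: diff_divide_distrib[symmetric] add_divide_distrib[symmetric] algebra_simps)
  finally show ?thesis .
qed

text \<open>Summing over \<open>a\<close> detects the congruence \<psi>(x + h) = \<psi>(x) modulo
  \<open>p\<close> by orthogonality, so the mean square in \<open>a\<close> becomes a Fourier
  transform in \<open>c\<close> of collision counts.\<close>

lemma sum_complete_sum_norm_sq:
  assumes p: "p > 0"
  shows "of_real (\<Sum>a\<in>{0..<p}. (norm (complete_sum \<psi> p a c))\<^sup>2) =
    of_int p * (\<Sum>h\<in>{0..<p}. of_nat (shift_collisions \<psi> p h) * e (of_int (- c * h) / of_int p))"
proof -
  let ?d = "\<lambda>x h. poly \<psi> (x + h) - poly \<psi> x"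
  let ?E = "\<lambda>h. e (of_int (- c * h) / of_int p)"
  have "of_real (\<Sum>a\<in>{0..<p}. (norm (complete_sum \<psi> p a c))\<^sup>2) =
     (\<Sum>a\<in>{0..<p}. \<Sum>h\<in>{0..<p}. \<Sum>x\<in>{0..<p}. e (of_int (a * ?d x h) / of_int p) * ?E h)"
    unfolding of_real_sum by (intro sum.cong refl complete_sum_norm_sq p)
  also have "\<dots> = (\<Sum>h\<in>{0..<p}. \<Sum>a\<in>{0..<p}. \<Sum>x\<in>{0..<p}. e (of_int (a * ?d x h) / of_int p) * ?E h)"
    by (rule sum.swap)
  also have "\<dots> = (\<Sum>h\<in>{0..<p}. \<Sum>x\<in>{0..<p}. \<Sum>a\<in>{0..<p}. e (of_int (a * ?d x h) / of_int p) * ?E h)"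
    by (intro sum.cong refl sum.swap)
  also have "\<dots> = (\<Sum>h\<in>{0..<p}. \<Sum>x\<in>{0..<p}. (if p dvd ?d x h then of_int p else 0) * ?E h)"
    unfolding sum_distrib_right[symmetric] by (simp only: sum_e_orthogonal[OF p])
  also have "\<dots> = (\<Sum>h\<in>{0..<p}. of_int p * (of_nat (shift_collisions \<psi> p h) * ?E h))"
  proof (intro sum.cong refl)
    fix h
    have "(\<Sum>x\<in>{0..<p}. (if p dvd ?d x h then of_int p else 0) * ?E h) =
        (\<Sum>x | x \<in> {0..<p} \<and> p dvd ?d x h. of_int p) * ?E h"
      unfolding sum_distrib_right[symmetric]
      by (subst sum.inter_filter[symmetric]) simp_all
    then show "(\<Sum>x\<in>{0..<p}. (if p dvd ?d x h then of_int p else 0) * ?E h) =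
      of_int p * (of_nat (shift_collisions \<psi> p h) * ?E h)"
      by (simp add: shift_collisions_def)
  qed
  finally show ?thesis by (simp only: sum_distrib_left)
qed

lemma parseval_mod:
  fixes f :: "int \<Rightarrow> complex"
  assumes p: "p > 0"
  shows "(\<Sum>c\<in>{0..<p}. (norm (\<Sum>h\<in>{0..<p}. f h * e (of_int (- c * h) / of_int p)))\<^sup>2)
       = of_int p * (\<Sum>h\<in>{0..<p}. (norm (f h))\<^sup>2)"
proof -
  let ?E = "\<lambda>c h. e (of_int (- c * h) / of_int p)"
  have EE: "?E c h * cnj (?E c g) = e (of_int (c * (g - h)) / of_int p)" for c h g
    by (simp add: e_diff[symmetric] diff_divide_distrib[symmetric] algebra_simps)
  have "complex_of_real (\<Sum>c\<in>{0..<p}. (norm (\<Sum>h\<in>{0..<p}. f h * ?E c h))\<^sup>2)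
      = (\<Sum>c\<in>{0..<p}. \<Sum>h\<in>{0..<p}. \<Sum>g\<in>{0..<p}. f h * ?E c h * cnj (f g * ?E c g))"
    by (simp only: of_real_sum complex_norm_square cnj_sum sum_product)
  also have "\<dots> = (\<Sum>c\<in>{0..<p}. \<Sum>h\<in>{0..<p}. \<Sum>g\<in>{0..<p}.
      f h * cnj (f g) * e (of_int (c * (g - h)) / of_int p))"
    unfolding EE[symmetric] by (simp add: mult_ac)
  also have "\<dots> = (\<Sum>h\<in>{0..<p}. \<Sum>c\<in>{0..<p}. \<Sum>g\<in>{0..<p}.
      f h * cnj (f g) * e (of_int (c * (g - h)) / of_int p))"
    by (rule sum.swap)
  also have "\<dots> = (\<Sum>h\<in>{0..<p}. \<Sum>g\<in>{0..<p}. \<Sum>c\<in>{0..<p}.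
      f h * cnj (f g) * e (of_int (c * (g - h)) / of_int p))"
    by (intro sum.cong refl sum.swap)
  also have "\<dots> = (\<Sum>h\<in>{0..<p}. \<Sum>g\<in>{0..<p}. f h * cnj (f g) * (if p dvd g - h then of_int p else 0))"
    unfolding sum_distrib_left[symmetric] by (simp only: sum_e_orthogonal[OF p])
  also have "\<dots> = (\<Sum>h\<in>{0..<p}. \<Sum>g\<in>{0..<p}. if g = h then f h * cnj (f h) * of_int p else 0)"
  \<comment> \<open>Both indices are least residues, so congruence modulo \<open>p\<close> is
    equality.\<close>
  proof (intro sum.cong refl)
    fix g h assume "g \<in> {0..<p}" "h \<in> {0..<p}"
    then have "p dvd g - h \<longleftrightarrow> g = h"
      by (metis atLeastLessThan_iff mod_eq_dvd_iff mod_pos_pos_trivial)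
    then show "f h * cnj (f g) * (if p dvd g - h then of_int p else 0)
        = (if g = h then f h * cnj (f h) * of_int p else 0)" by simp
  qed
  also have "\<dots> = (\<Sum>h\<in>{0..<p}. f h * cnj (f h) * of_int p)"
    by simp
  also have "\<dots> = complex_of_real (of_int p * (\<Sum>h\<in>{0..<p}. (norm (f h))\<^sup>2))"
    by (simp only: of_real_mult of_real_sum complex_norm_square sum_distrib_left of_real_of_int_eq mult.commute)
  finally show ?thesis by (simp only: of_real_eq_iff)
qed

text \<open>The mean over \<open>a\<close> of the squared norm is \<open>p\<close> plus an error
  depending on \<open>c\<close>. With the threshold \<open>p/2\<close>, a numerator that is not good
  forces an error of size at least \<open>p/2\<close>.\<close>

definition good_numerator :: "int poly \<Rightarrow> int \<Rightarrow> int \<Rightarrow> bool" where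
  "good_numerator \<psi> p c \<longleftrightarrow> (\<exists>a. (norm (complete_sum \<psi> p a c))\<^sup>2 \<ge> of_int p / 2)"

text \<open>Each exceptional \<open>c\<close> contributes at least \<open>p\<^sup>2/4\<close> to the
  sum of squared errors, while Parseval's identity and the collision bound \<open>k\<close> cap that
  sum by \<open>p\<^sup>2 k\<^sup>2\<close>, where \<open>k = degree \<psi>\<close>.\<close>

lemma card_not_good_numerator_le:
  assumes p: "prime p" and lc: "\<not> p dvd lead_coeff \<psi>" and deg: "degree \<psi> > 0" "int (degree \<psi>) < p"
  shows "card {c \<in> {0..<p}. \<not> good_numerator \<psi> p c} \<le> 4 * (degree \<psi>)\<^sup>2"
proof -
  have p0: "p > 0" using p by (rule prime_gt_0_int)
  let ?k = "degree \<psi>"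
  let ?Bad = "{c \<in> {0..<p}. \<not> good_numerator \<psi> p c}"
  \<comment> \<open>The shift \<open>h = 0\<close> has all \<open>p\<close> residues as collisions
    and supplies the main term \<open>p\<close> in \<open>T\<close>; the nonzero shifts form the
    error \<open>R\<close>.\<close>
  define f :: "int \<Rightarrow> complex" where "f h = (if h = 0 then 0 else of_nat (shift_collisions \<psi> p h))" for h
  define R where "R c = (\<Sum>h\<in>{0..<p}. f h * e (of_int (- c * h) / of_int p))" for c
  have T: "of_real (\<Sum>a\<in>{0..<p}. (norm (complete_sum \<psi> p a c))\<^sup>2) = of_int p * (of_int p + R c)" for c
  proof -
    have "shift_collisions \<psi> p 0 = nat p" by (simp add: shift_collisions_def del: atLeastLessThan_iff)
    then have "(\<Sum>h\<in>{0..<p}. of_nat (shift_collisions \<psi> p h) * e (of_int (- c * h) / of_int p))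
        = of_int p + R c"
      using p0 by (simp add: R_def f_def sum.remove[of "{0..<p}" 0] cong: sum.cong_simp)
    then show ?thesis using sum_complete_sum_norm_sq[OF p0] by metis
  qed
  have bad: "(of_int p)\<^sup>2 / 4 \<le> (norm (R c))\<^sup>2" if "c \<in> ?Bad" for c
  proof -
    let ?s = "\<Sum>a\<in>{0..<p}. (norm (complete_sum \<psi> p a c))\<^sup>2"
    have "?s \<le> (\<Sum>a\<in>{0..<p}. of_int p / 2)"
      using that by (intro sum_mono) (auto simp: good_numerator_def not_le less_imp_le)
    then have "?s \<le> of_int p * (of_int p / 2)" using p0 by simp
    moreover have "?s = of_int p * (of_int p + Re (R c))"
      using arg_cong[OF T[of c], of Re] by simp
    ultimately have "of_int p + Re (R c) \<le> of_int p / 2"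
      using p0 by simp
    then have "of_int p / 2 \<le> \<bar>Re (R c)\<bar>" by linarith
    also have "\<dots> \<le> norm (R c)" by (rule abs_Re_le_cmod)
    finally have "(of_int p / 2)\<^sup>2 \<le> (norm (R c))\<^sup>2"
      using p0 by (intro power_mono) auto
    then show ?thesis by (simp add: power_divide)
  qed
  have fle: "(norm (f h))\<^sup>2 \<le> (real ?k)\<^sup>2" if "h \<in> {0..<p}" for h
  proof (cases "h = 0")
    case False
    then have "\<not> p dvd h" using that by (auto dest: zdvd_imp_le)
    from card_shift_collisions_le[OF p lc deg this] False show ?thesis
      by (auto simp: f_def shift_collisions_def intro!: power_mono)
  qed (simp add: f_def)
  have "real (card ?Bad) * ((of_int p)\<^sup>2 / 4) \<le> (\<Sum>c\<in>?Bad. (norm (R c))\<^sup>2)"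
    using sum_mono[of ?Bad "\<lambda>_. (of_int p)\<^sup>2 / 4", OF bad] by simp
  also have "\<dots> \<le> (\<Sum>c\<in>{0..<p}. (norm (R c))\<^sup>2)"
    by (intro sum_mono2) auto
  also have "\<dots> = of_int p * (\<Sum>h\<in>{0..<p}. (norm (f h))\<^sup>2)"
    unfolding R_def by (rule parseval_mod[OF p0])
  also have "\<dots> \<le> of_int p * (\<Sum>h\<in>{0..<p}. (real ?k)\<^sup>2)"
    using p0 by (intro mult_left_mono sum_mono fle) auto
  also have "\<dots> = (of_int p)\<^sup>2 * (real ?k)\<^sup>2"
    using p0 by (simp add: power2_eq_square)
  finally have "(of_int p)\<^sup>2 * real (card ?Bad) \<le> (of_int p)\<^sup>2 * (4 * (real ?k)\<^sup>2)"
    by (simp add: mult_ac)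
  then have "real (card ?Bad) \<le> 4 * (real ?k)\<^sup>2"
    using p0 by simp
  then have "real (card ?Bad) \<le> real (4 * ?k\<^sup>2)" by simp
  then show ?thesis by (simp only: of_nat_le_iff)
qed

subsection \<open>Incomplete sums near a rational point\<close>

lemma norm_sum_ge_if_close_to_1:
  fixes z :: "nat \<Rightarrow> complex"
  assumes "\<And>j. j < M \<Longrightarrow> norm (z j - 1) \<le> 1 / 2"
  shows "norm (\<Sum>j<M. z j) \<ge> real M / 2"
proof -
  have "norm ((\<Sum>j<M. z j) - of_nat M) = norm (\<Sum>j<M. z j - 1)"
    by (simp add: sum_subtractf)
  also have "\<dots> \<le> real M * (1 / 2)"
    using sum_norm_le[of "{..<M}" "\<lambda>j. z j - 1" "\<lambda>_. 1 / 2"] assms by simp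
  finally have "norm ((\<Sum>j<M. z j) - of_nat M) \<le> real M / 2" by simp
  moreover have "norm (of_nat M :: complex) - norm ((\<Sum>j<M. z j) - of_nat M) \<le> norm (\<Sum>j<M. z j)"
    using norm_triangle_ineq2[of "of_nat M" "of_nat M - (\<Sum>j<M. z j)"] by (simp add: norm_minus_commute)
  ultimately show ?thesis by simp
qed

text \<open>Blocks of length \<open>p\<close> differ only by the phases \<open>z j\<close>, so the
  sum factors exactly as the sum of the \<open>z j\<close> times the first block. The twist moves
  the first block by at most 2 pi < 7, and over \<open>M\<close>, at most \<open>p/16\<close>,
  blocks the phases stay within pi/8 < 1/2 of 1.\<close>

lemma norm_twisted_periodic_sum_ge:
  fixes t :: "int \<Rightarrow> complex" and p :: int and M :: nat
  assumes p: "p > 0" and per: "\<And>x. t (x + p) = t x" and t1: "\<And>x. norm (t x) \<le> 1"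
    and \<theta>: "\<bar>\<theta>\<bar> * (of_int p)\<^sup>2 \<le> 1" and M: "16 * int M \<le> p"
  shows "norm (\<Sum>x\<in>{1..p * int M}. t x * e (\<theta> * of_int x))
      \<ge> real M * (norm (\<Sum>x\<in>{0..<p}. t x) / 2 - 7)"
proof -
  define S where "S = (\<Sum>x\<in>{0..<p}. t x)"
  define z where "z j = e (\<theta> * of_int (p * int j))" for j :: nat
  have S': "(\<Sum>x\<in>{1..p}. t x) = S"
  proof -
    have "(\<Sum>x\<in>{1..p}. t x) = (\<Sum>x\<in>{0..<p}. t (x + 1))"
      by (rule sum.reindex_bij_witness[of _ "\<lambda>x. x + 1" "\<lambda>x. x - 1"]) auto
    also have "\<dots> = S" unfolding S_def by (rule sum_periodic_shift[of t, OF per p])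
    finally show ?thesis .
  qed
  have perm: "t (x + p * int n) = t x" for x n
    by (rule periodic_add_mult[of t, OF per])
  have split: "(\<Sum>x\<in>{1..p * int m}. t x * e (\<theta> * of_int x))
      = (\<Sum>j<m. z j * (\<Sum>x\<in>{1..p}. t x * e (\<theta> * of_int x)))" for m
  proof (induction m)
    case (Suc m)
    have "{1..n + p} = {1..n} \<union> {n + 1..n + p}" if "n \<ge> 0" for n
      using p that by auto
    from this[of "p * int m"] have "{1..p * int (Suc m)} = {1..p * int m} \<union> {p * int m + 1..p * int m + p}"
      using p by (simp add: distrib_left add.commute)
    then have "(\<Sum>x\<in>{1..p * int (Suc m)}. t x * e (\<theta> * of_int x))
        = (\<Sum>x\<in>{1..p * int m}. t x * e (\<theta> * of_int x))
        + (\<Sum>x\<in>{p * int m + 1..p * int m + p}. t x * e (\<theta> * of_int x))"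
      by (simp add: sum.union_disjoint)
    also have "(\<Sum>x\<in>{p * int m + 1..p * int m + p}. t x * e (\<theta> * of_int x))
        = (\<Sum>x\<in>{1..p}. t (x + p * int m) * e (\<theta> * of_int (x + p * int m)))"
      by (rule sum.reindex_bij_witness[of _ "\<lambda>x. x + p * int m" "\<lambda>x. x - p * int m"]) auto
    also have "\<dots> = z m * (\<Sum>x\<in>{1..p}. t x * e (\<theta> * of_int x))"
      unfolding sum_distrib_left
      by (intro sum.cong refl) (simp only: perm z_def of_int_add distrib_left e_add mult_ac)
    finally show ?case using Suc by simp
  qed simp
  have "norm ((\<Sum>x\<in>{1..p}. t x * e (\<theta> * of_int x)) - S) \<le> 7"
  proof -
    have "(\<Sum>x\<in>{1..p}. t x * e (\<theta> * of_int x)) - S = (\<Sum>x\<in>{1..p}. t x * (e (\<theta> * of_int x) - 1))"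
      by (simp add: S'[symmetric] sum_subtractf[symmetric] right_diff_distrib)
    also have "norm \<dots> \<le> (\<Sum>x\<in>{1..p}. 2 * pi * (\<bar>\<theta>\<bar> * of_int p))"
    proof (rule sum_norm_le)
      fix x assume x: "x \<in> {1..p}"
      have "norm (t x * (e (\<theta> * of_int x) - 1)) \<le> 1 * (2 * pi * \<bar>\<theta> * of_int x\<bar>)"
        unfolding norm_mult by (intro mult_mono t1 norm_e_diff_1_le) auto
      also have "\<dots> \<le> 2 * pi * (\<bar>\<theta>\<bar> * of_int p)"
        using x by (auto simp: abs_mult intro!: mult_left_mono)
      finally show "norm (t x * (e (\<theta> * of_int x) - 1)) \<le> 2 * pi * (\<bar>\<theta>\<bar> * of_int p)" .
    qed
    also have "\<dots> = 2 * pi * (\<bar>\<theta>\<bar> * (of_int p)\<^sup>2)"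
      using p by (simp add: power2_eq_square)
    also have "\<dots> \<le> 2 * pi * 1" using \<theta> by (intro mult_left_mono) auto
    also have "\<dots> \<le> 7" using pi_less_4 pi_approx by simp
    finally show ?thesis .
  qed
  then have inner: "norm (\<Sum>x\<in>{1..p}. t x * e (\<theta> * of_int x)) \<ge> norm S - 7"
    using norm_triangle_ineq2[of S "(\<Sum>x\<in>{1..p}. t x * e (\<theta> * of_int x))"]
    by (simp add: norm_minus_commute)
  have outer: "norm (\<Sum>j<M. z j) \<ge> real M / 2"
  proof (rule norm_sum_ge_if_close_to_1)
    fix j assume "j < M"
    have "norm (z j - 1) \<le> 2 * pi * \<bar>\<theta> * of_int (p * int j)\<bar>"
      unfolding z_def by (rule norm_e_diff_1_le)
    also have "\<dots> = 2 * pi * (\<bar>\<theta>\<bar> * of_int p * real j)"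
      using p by (simp add: abs_mult)
    also have "\<dots> \<le> 2 * pi * (\<bar>\<theta>\<bar> * of_int p * (of_int p / 16))"
    proof (intro mult_left_mono)
      have "16 * int j \<le> p" using M \<open>j < M\<close> by linarith
      then show "real j \<le> of_int p / 16" by linarith
    qed (use p in auto)
    also have "\<dots> = pi / 8 * (\<bar>\<theta>\<bar> * (of_int p)\<^sup>2)"
      by (simp add: power2_eq_square)
    also have "\<dots> \<le> pi / 8 * 1" using \<theta> by (intro mult_left_mono) auto
    also have "\<dots> \<le> 1 / 2" using pi_less_4 by simp
    finally show "norm (z j - 1) \<le> 1 / 2" .
  qed
  show ?thesis
  \<comment> \<open>For \<open>norm S\<close> at most 7 the claimed bound is not positive; otherwise
    both lower bounds are nonnegative and may be multiplied.\<close>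
  proof (cases "norm S \<le> 7")
    case True
    then have "real M * (norm S / 2 - 7) \<le> 0" by (intro mult_nonneg_nonpos) auto
    then show ?thesis unfolding S_def using norm_ge_zero order_trans by blast
  next
    case False
    have "real M * (norm S / 2 - 7) \<le> real M / 2 * (norm S - 7)"
      by (simp add: algebra_simps)
    also have "\<dots> \<le> norm (\<Sum>j<M. z j) * norm (\<Sum>x\<in>{1..p}. t x * e (\<theta> * of_int x))"
      using False by (intro mult_mono outer inner) auto
    also have "\<dots> = norm (\<Sum>x\<in>{1..p * int M}. t x * e (\<theta> * of_int x))"
      unfolding split[of M] sum_distrib_right[symmetric] norm_mult ..
    finally show ?thesis unfolding S_def .
  qed
qed

text \<open>The free variable now multiplies \<phi> + X alone and \<alpha> only the linear term, so
  \<beta> can be made rational with any denominator whatever \<alpha> is. This is the source of the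
  minus sign in \<open>complete_sum\<close>.\<close>

lemma expsum_shear:
  "expsum \<phi> (of_int N) (\<beta> - \<alpha>) \<alpha> =
     (\<Sum>x\<in>{1..N}. e (\<beta> * of_int (poly (\<phi> + [:0, 1:]) x) - \<alpha> * of_int x))"
proof -
  have "{x. 1 \<le> x \<and> real_of_int x \<le> real_of_int N} = {1..N}" by auto
  then show ?thesis unfolding expsum_def
    by (intro sum.cong) (simp_all add: algebra_simps)
qed

text \<open>Take \<beta> = a/p with \<open>a\<close> from the good numerator. The sum becomes
  \<open>p div 16\<close> periods of the complete sum, twisted by \<theta> = c/p - \<alpha>, which
  is below \<open>1/p\<^sup>2\<close> in size. Its norm is then at least of order \<open>p\<close>
  times the square root of \<open>p\<close>, and the length is at most
  \<open>p\<^sup>2\<close>.\<close>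

lemma expsum_large_near_good_numerator:
  fixes \<phi> :: "int poly" and p c :: int
  defines "\<psi> \<equiv> \<phi> + [:0, 1:]"
  assumes p: "p \<ge> 40000" and good: "good_numerator \<psi> p c"
    and \<alpha>: "\<bar>\<alpha> - of_int c / of_int p\<bar> < 1 / (of_int p)\<^sup>2"
  shows "\<exists>\<alpha>1\<in>torus. norm (expsum \<phi> (of_int (p * (p div 16))) \<alpha>1 \<alpha>)
            \<ge> 1/128 * of_int (p * (p div 16)) powr (3/4)"
proof -
  obtain a where a: "(norm (complete_sum \<psi> p a c))\<^sup>2 \<ge> of_int p / 2"
    using good by (auto simp: good_numerator_def)
  define \<theta> where "\<theta> = of_int c / of_int p - \<alpha>"
  define t where "t x = e (of_int (a * poly \<psi> x - c * x) / of_int p)" for x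
  define M where "M = nat (p div 16)"
  have p0: "p > 0" using p by simp
  have M: "int M = p div 16" using p by (simp add: M_def)
  have M_ge: "real M \<ge> of_int p / 32"
  proof -
    have "32 * (p div 16) \<ge> p" using p by linarith
    then show ?thesis using M by linarith
  qed
  have "norm (\<Sum>x\<in>{1..p * int M}. t x * e (\<theta> * of_int x))
      \<ge> real M * (norm (\<Sum>x\<in>{0..<p}. t x) / 2 - 7)"
  proof (rule norm_twisted_periodic_sum_ge[OF p0])
    show "t (x + p) = t x" for x unfolding t_def by (rule e_poly_phase_periodic[OF p0])
    show "norm (t x) \<le> 1" for x by (simp add: t_def)
    show "\<bar>\<theta>\<bar> * (of_int p)\<^sup>2 \<le> 1"
      using \<alpha> p0 by (simp add: \<theta>_def abs_minus_commute field_simps)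
    show "16 * int M \<le> p" unfolding M by linarith
  qed
  moreover have "(\<Sum>x\<in>{0..<p}. t x) = complete_sum \<psi> p a c"
    by (simp add: t_def complete_sum_def)
  moreover have "(\<Sum>x\<in>{1..p * int M}. t x * e (\<theta> * of_int x)) =
      expsum \<phi> (of_int (p * (p div 16))) (of_int a / of_int p - \<alpha>) \<alpha>"
    unfolding expsum_shear M \<psi>_def[symmetric] t_def \<theta>_def e_add[symmetric] using p0
    by (intro sum.cong refl arg_cong[of _ _ e]) (simp add: field_simps)
  ultimately have 1: "norm (expsum \<phi> (of_int (p * (p div 16))) (of_int a / of_int p - \<alpha>) \<alpha>)
      \<ge> real M * (norm (complete_sum \<psi> p a c) / 2 - 7)" by simp
  let ?r = "sqrt (of_int p)"
  have r: "?r \<ge> 200"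
  proof -
    have "sqrt 40000 \<le> ?r" using p by (intro real_sqrt_le_mono) auto
    moreover have "sqrt 40000 = (200::real)" by (rule real_sqrt_unique) auto
    ultimately show ?thesis by simp
  qed
  \<comment> \<open>Here 4/9 < 1/2. Halving leaves \<open>?r / 3\<close>, and
    \<open>?r \<ge> 200\<close> makes the surplus over \<open>?r / 4\<close> larger than the loss
    7.\<close>
  have "(2/3 * ?r)\<^sup>2 \<le> (norm (complete_sum \<psi> p a c))\<^sup>2"
    using a p0 by (simp add: power_mult_distrib power2_eq_square)
  then have "2/3 * ?r \<le> norm (complete_sum \<psi> p a c)"
    by (rule power2_le_imp_le) simp
  then have 2: "real M * (?r / 4) \<le> real M * (norm (complete_sum \<psi> p a c) / 2 - 7)"
    using r by (intro mult_left_mono) auto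
  have 3: "1/128 * of_int (p * (p div 16)) powr (3/4) \<le> real M * (?r / 4)"
  proof -
    have "of_int (p * (p div 16)) \<le> (of_int p :: real) powr 2"
    proof -
      have "p * (p div 16) \<le> p * p" using p0 by (intro mult_left_mono) auto
      then have "real_of_int (p * (p div 16)) \<le> of_int (p * p)" by (simp only: of_int_le_iff)
      then show ?thesis using p0 by (simp add: powr_numeral power2_eq_square)
    qed
    then have "of_int (p * (p div 16)) powr (3/4) \<le> ((of_int p :: real) powr 2) powr (3/4)"
      using p0 by (intro powr_mono2) auto
    also have "\<dots> = of_int p powr (1 + 1/2)" by (simp add: powr_powr)
    also have "\<dots> = of_int p * ?r" using p0 by (simp only: powr_add powr_half_sqrt) simp
    also have "\<dots> \<le> (32 * real M) * ?r" using M_ge p0 by (intro mult_right_mono) auto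
    finally show ?thesis by simp
  qed
  have "expsum \<phi> P (frac \<beta>) \<alpha> = expsum \<phi> P \<beta> \<alpha>" for P \<beta>
    using expsum_periodic[of \<phi> P "frac \<beta>" "\<lfloor>\<beta>\<rfloor>" \<alpha> 0] by (simp add: frac_def)
  moreover have "frac \<beta> \<in> torus" for \<beta> :: real by (simp add: torus_def frac_lt_1)
  ultimately show ?thesis using order_trans[OF 3 order_trans[OF 2 1]] by metis
qed

subsection \<open>Approximation by fractions with prime denominator\<close>

text \<open>Chebyshev's inequality for the number \<open>F\<close> of events that occur: where none
  occurs, \<open>F\<close> deviates from its mean \<mu> by exactly \<mu>, so the variance is at
  least the probability of that set times \<open>\<mu>\<^sup>2\<close>.\<close>

lemma (in prob_space) prob_none_le_second_moment:
  assumes fin: "finite I" and A [measurable]: "\<And>i. i \<in> I \<Longrightarrow> A i \<in> events"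
  shows "prob {x \<in> space M. \<forall>i\<in>I. x \<notin> A i} * (\<Sum>i\<in>I. prob (A i))\<^sup>2
       \<le> (\<Sum>i\<in>I. \<Sum>j\<in>I. prob (A i \<inter> A j)) - (\<Sum>i\<in>I. prob (A i))\<^sup>2"
proof -
  define F where "F x = (\<Sum>i\<in>I. indicator (A i) x :: real)" for x
  define \<mu> where "\<mu> = (\<Sum>i\<in>I. prob (A i))"
  let ?B = "{x \<in> space M. \<forall>i\<in>I. x \<notin> A i}"
  have [measurable]: "?B \<in> events" using fin by measurable
  have ind: "integrable M (indicator (A i) :: _ \<Rightarrow> real)" if "i \<in> I" for i
    using that A by (simp add: integrable_indicator_iff emeasure_eq_measure)
  have ind2: "integrable M (indicator (A i \<inter> A j) :: _ \<Rightarrow> real)" if "i \<in> I" "j \<in> I" for i j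
    using that A by (simp add: integrable_indicator_iff emeasure_eq_measure sets.Int)
  have F2: "(F x)\<^sup>2 = (\<Sum>i\<in>I. \<Sum>j\<in>I. indicator (A i \<inter> A j) x)" for x
    unfolding F_def power2_eq_square sum_product by (simp add: indicator_inter_arith)
  have intF: "integrable M F" unfolding F_def by (intro Bochner_Integration.integrable_sum ind)
  have intF2: "integrable M (\<lambda>x. (F x)\<^sup>2)"
    unfolding F2 by (intro Bochner_Integration.integrable_sum ind2)
  have EF: "expectation F = \<mu>"
    unfolding F_def \<mu>_def by (subst Bochner_Integration.integral_sum) (auto intro!: ind sum.cong dest: A sets.sets_into_space simp: Int_absorb2)
  have EF2: "expectation (\<lambda>x. (F x)\<^sup>2) = (\<Sum>i\<in>I. \<Sum>j\<in>I. prob (A i \<inter> A j))"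
  proof -
    have "expectation (\<lambda>x. (F x)\<^sup>2)
        = (\<Sum>i\<in>I. expectation (\<lambda>x. \<Sum>j\<in>I. indicator (A i \<inter> A j) x))"
      unfolding F2 by (intro Bochner_Integration.integral_sum Bochner_Integration.integrable_sum ind2)
    also have "\<dots> = (\<Sum>i\<in>I. \<Sum>j\<in>I. expectation (indicator (A i \<inter> A j)))"
      by (intro sum.cong refl Bochner_Integration.integral_sum ind2)
    also have "\<dots> = (\<Sum>i\<in>I. \<Sum>j\<in>I. prob (A i \<inter> A j))"
      using A by (intro sum.cong refl) (simp add: Int_absorb2 le_infI1 sets.sets_into_space)
    finally show ?thesis .
  qed
  have "prob ?B * \<mu>\<^sup>2 = expectation (\<lambda>x. \<mu>\<^sup>2 * indicator ?B x)"
    by (simp add: mult.commute)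
  also have "\<dots> \<le> expectation (\<lambda>x. (F x - expectation F)\<^sup>2)"
  proof (rule integral_mono)
    show "integrable M (\<lambda>x. \<mu>\<^sup>2 * indicator ?B x)"
      by (intro integrable_mult_right) (simp add: integrable_indicator_iff emeasure_eq_measure)
    show "integrable M (\<lambda>x. (F x - expectation F)\<^sup>2)"
      unfolding power2_diff using intF intF2 by (intro Bochner_Integration.integrable_add Bochner_Integration.integrable_diff) auto
    show "\<mu>\<^sup>2 * indicator ?B x \<le> (F x - expectation F)\<^sup>2" for x
      by (auto simp: EF F_def indicator_def split: if_splits)
  qed
  also have "\<dots> = (\<Sum>i\<in>I. \<Sum>j\<in>I. prob (A i \<inter> A j)) - \<mu>\<^sup>2"
    using variance_eq[OF intF intF2] by (simp only: EF EF2)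
  finally show ?thesis unfolding \<mu>_def .
qed

lemma card_int_abs_less_le:
  assumes "R \<ge> 0"
  shows "finite {n::int. \<bar>real_of_int n\<bar> < R}" "real (card {n::int. \<bar>real_of_int n\<bar> < R}) \<le> 2 * R + 1"
proof -
  have sub: "{n::int. \<bar>real_of_int n\<bar> < R} \<subseteq> {-\<lfloor>R\<rfloor>..\<lfloor>R\<rfloor>}" by (auto; linarith)
  then show "finite {n::int. \<bar>real_of_int n\<bar> < R}" by (rule finite_subset) simp
  have "card {n::int. \<bar>real_of_int n\<bar> < R} \<le> card {-\<lfloor>R\<rfloor>..\<lfloor>R\<rfloor>}" by (intro card_mono sub) simp
  also have "\<dots> = nat (2 * \<lfloor>R\<rfloor> + 1)" by simp
  finally have "real (card {n::int. \<bar>real_of_int n\<bar> < R}) \<le> real (nat (2 * \<lfloor>R\<rfloor> + 1))"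
    by (simp only: of_nat_le_iff)
  also have "\<dots> \<le> 2 * R + 1" using assms by (simp; linarith)
  finally show "real (card {n::int. \<bar>real_of_int n\<bar> < R}) \<le> 2 * R + 1" .
qed

section \<open>Neighbourhoods of fractions, their measures and overlaps\<close>

definition near_fractions :: "nat set \<Rightarrow> nat \<Rightarrow> real set" where
  "near_fractions C p = (\<Union>c\<in>C. ball (real c / real p) (1 / (real p)\<^sup>2))"

lemma near_fractions_borel [measurable]: "near_fractions C p \<in> sets borel"
  unfolding near_fractions_def by (intro borel_open open_UN) auto

text \<open>Leaving out the numerators 0 and \<open>p\<close> keeps every interval inside the
  fundamental domain, with no wrapping around.\<close>

lemma near_fractions_subset_torus:
  assumes "C \<subseteq> {1..<p}" shows "near_fractions C p \<subseteq> torus"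
proof
  fix x assume "x \<in> near_fractions C p"
  then obtain c where c: "c \<in> C" "\<bar>real c / real p - x\<bar> < 1 / (real p)\<^sup>2"
    by (auto simp: near_fractions_def dist_real_def)
  have c': "1 \<le> real c" "real c \<le> real p - 1" "real p > 0" using c(1) assms by auto
  have "1 / (real p)\<^sup>2 \<le> 1 / real p"
    using c' by (simp add: power2_eq_square field_simps)
  moreover have "1 / real p \<le> real c / real p" "real c / real p \<le> 1 - 1 / real p"
    using c' by (auto simp: field_simps)
  ultimately show "x \<in> torus" using c(2) unfolding torus_def by auto
qed

lemma measure_ball_real: "r \<ge> 0 \<Longrightarrow> measure lborel (ball (x::real) r) = 2 * r"
  by (simp add: ball_eq_greaterThanLessThan)

lemma fmeasurable_ball: "ball (x::real) r \<in> fmeasurable lborel"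
  by (cases "r \<ge> 0") (simp_all add: ball_eq_greaterThanLessThan fmeasurableI)

text \<open>Distinct centres are at least \<open>1/p\<close> apart, and two radii add up to
  \<open>2/p\<^sup>2\<close>, at most \<open>1/p\<close> once \<open>p \<ge> 2\<close>, so the
  intervals are disjoint. For smaller \<open>p\<close> there are no numerators.\<close>

lemma measure_near_fractions:
  assumes "C \<subseteq> {1..<p}"
  shows "measure lborel (near_fractions C p) = real (card C) * (2 / (real p)\<^sup>2)"
proof (cases "p \<ge> 2")
  case False
  then have "C = {}" using assms by auto
  then show ?thesis by (simp add: near_fractions_def)
next
  case True
  have fin: "finite C" using assms by (rule finite_subset) simp
  have "disjoint_family_on (\<lambda>c. ball (real c / real p) (1 / (real p)\<^sup>2)) C"
    unfolding disjoint_family_on_def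
  proof (intro ballI impI)
    fix c d :: nat assume "c \<noteq> d"
    then have "\<bar>real c - real d\<bar> \<ge> 1" by linarith
    then have "1 / real p \<le> \<bar>real c - real d\<bar> / real p" by (intro divide_right_mono) auto
    also have "\<dots> = dist (real c / real p) (real d / real p)"
      by (simp add: dist_real_def diff_divide_distrib[symmetric])
    finally have *: "1 / real p \<le> dist (real c / real p) (real d / real p)" .
    have "2 / (real p)\<^sup>2 \<le> 1 / real p" using True by (simp add: power2_eq_square field_simps)
    with * show "ball (real c / real p) (1 / (real p)\<^sup>2) \<inter> ball (real d / real p) (1 / (real p)\<^sup>2) = {}"
      by (intro disjoint_ballI) simp
  qed
  then have "measure lborel (near_fractions C p) = (\<Sum>c\<in>C. measure lborel (ball (real c / real p) (1 / (real p)\<^sup>2)))"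
    unfolding near_fractions_def
    by (intro measure_finite_Union fin) (auto simp: ball_eq_greaterThanLessThan)
  also have "\<dots> = real (card C) * (2 / (real p)\<^sup>2)"
    by (simp add: measure_ball_real)
  finally show ?thesis .
qed

text \<open>Two intervals around \<open>c/p\<close> and \<open>d/q\<close> can only meet if \<open>\<bar>c q - d p\<bar> < q/p + p/q\<close>, and \<open>c q - d p\<close>
  determines \<open>(c, d)\<close>. As \<open>p < q\<close>, bounding each overlap by the shorter interval still gives the
  main term \<open>4/(p q)\<close> that independence would predict.\<close>

lemma measure_near_fractions_Int_le:
  assumes "coprime p q" "p < q" "p > 0"
  shows "measure lborel (near_fractions {1..<p} p \<inter> near_fractions {1..<q} q)
       \<le> 4 / (real p * real q) + 6 / (real q)\<^sup>2"
proof -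
  let ?U = "\<lambda>c. ball (real c / real p) (1 / (real p)\<^sup>2)"
  let ?V = "\<lambda>d. ball (real d / real q) (1 / (real q)\<^sup>2)"
  let ?R = "real q / real p + real p / real q"
  let ?n = "\<lambda>(c, d). int c * int q - int d * int p"
  define K where "K = {(c, d) \<in> {1..<p} \<times> {1..<q}. ?U c \<inter> ?V d \<noteq> {}}"
  have q: "q > 0" using assms by simp
  have finK: "finite K" unfolding K_def by (rule finite_subset[of _ "{1..<p} \<times> {1..<q}"]) auto
  have "inj_on ?n K"
  proof (rule inj_onI, clarsimp)
    fix c d c' d' assume K: "(c, d) \<in> K" "(c', d') \<in> K"
      and eq: "int c * int q - int d * int p = int c' * int q - int d' * int p"
    then have "(int c - int c') * int q = (int d - int d') * int p" by (simp add: algebra_simps)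
    then have "int p dvd (int c - int c') * int q" by simp
    then have "int p dvd int c - int c'"
      using assms(1) by (simp add: coprime_dvd_mult_left_iff)
    then have "int c mod int p = int c' mod int p" by (simp add: mod_eq_dvd_iff)
    then have "c = c'" using K by (simp add: K_def)
    with eq assms(3) show "c = c' \<and> d = d'" by simp
  qed
  moreover have "?n ` K \<subseteq> {n. \<bar>real_of_int n\<bar> < ?R}"
  proof
    fix n assume "n \<in> ?n ` K"
    then obtain c d where cd: "(c, d) \<in> K" "n = int c * int q - int d * int p" by auto
    from cd(1) have "?U c \<inter> ?V d \<noteq> {}" by (simp add: K_def)
    then obtain x where "dist (real c / real p) x < 1 / (real p)\<^sup>2" "dist (real d / real q) x < 1 / (real q)\<^sup>2"
      by auto
    then have "dist (real c / real p) (real d / real q) < 1 / (real p)\<^sup>2 + 1 / (real q)\<^sup>2"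
      using dist_triangle2[of "real c / real p" "real d / real q" x] by linarith
    then have "dist (real c / real p) (real d / real q) * (real p * real q)
        < (1 / (real p)\<^sup>2 + 1 / (real q)\<^sup>2) * (real p * real q)"
      using assms(3) q by (intro mult_strict_right_mono) auto
    moreover have "(1 / (real p)\<^sup>2 + 1 / (real q)\<^sup>2) * (real p * real q) = ?R"
      using assms(3) q by (simp add: field_simps power2_eq_square)
    moreover have "dist (real c / real p) (real d / real q) * (real p * real q)
        = \<bar>(real c / real p - real d / real q) * (real p * real q)\<bar>"
      by (simp add: dist_real_def abs_mult)
    moreover have "(real c / real p - real d / real q) * (real p * real q) = real_of_int n"
    proof -
      have "(real c / real p - real d / real q) * (real p * real q) = real c * real q - real d * real p"
        using assms(3) q by (simp add: left_diff_distrib)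
      then show ?thesis using cd(2) by simp
    qed
    ultimately show "n \<in> {n. \<bar>real_of_int n\<bar> < ?R}" by simp
  qed
  moreover have "?R \<ge> 0" by simp
  ultimately have "real (card K) \<le> 2 * ?R + 1"
    using card_int_abs_less_le[of ?R] card_inj_on_le[of ?n K "{n. \<bar>real_of_int n\<bar> < ?R}"] by linarith
  \<comment> \<open>The term \<open>p/q\<close> of \<open>?R\<close> is at most 1.\<close>
  also have "\<dots> \<le> 2 * (real q / real p) + 3"
    using assms(2) q by (simp add: field_simps)
  finally have card: "real (card K) \<le> 2 * (real q / real p) + 3" .
  let ?W = "\<Union>k\<in>K. ?V (snd k)"
  have "measure lborel (near_fractions {1..<p} p \<inter> near_fractions {1..<q} q) \<le> measure lborel ?W"
  proof (rule measure_mono_fmeasurable)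
    show "near_fractions {1..<p} p \<inter> near_fractions {1..<q} q \<subseteq> ?W"
    proof
      fix x assume "x \<in> near_fractions {1..<p} p \<inter> near_fractions {1..<q} q"
      then obtain c d where cd: "c \<in> {1..<p}" "d \<in> {1..<q}" "x \<in> ?U c" "x \<in> ?V d"
        unfolding near_fractions_def by blast
      then have "(c, d) \<in> K" unfolding K_def by blast
      with cd(4) show "x \<in> ?W" by force
    qed
    show "?W \<in> fmeasurable lborel"
      by (intro fmeasurable.finite_UN finK fmeasurable_ball)
  qed simp
  also have "\<dots> \<le> (\<Sum>k\<in>K. measure lborel (?V (snd k)))"
    by (intro measure_UNION_le finK) simp
  also have "\<dots> = real (card K) * (2 / (real q)\<^sup>2)"
    by (simp add: measure_ball_real)
  also have "\<dots> \<le> (2 * (real q / real p) + 3) * (2 / (real q)\<^sup>2)"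
    by (intro mult_right_mono card) simp
  also have "\<dots> = 4 / (real p * real q) + 6 / (real q)\<^sup>2"
    using q assms(3) by (simp add: distrib_right add_divide_distrib power2_eq_square)
  finally show ?thesis .
qed

text \<open>By symmetry the off-diagonal part is twice that over \<open>p < q\<close>, where the
  error \<open>b q\<close> is repeated at most \<open>q\<close> times. With \<open>b q\<close> of
  order \<open>1/q\<^sup>2\<close>, the total error has the order of the sum of \<open>1/q\<close>,
  that is, of the mean.\<close>

lemma sum_diagonal_add_off_diagonal_le:
  fixes a b :: "nat \<Rightarrow> real" and g :: "nat \<Rightarrow> nat \<Rightarrow> real"
  assumes fin: "finite I"
    and diag: "\<And>p. p \<in> I \<Longrightarrow> g p p \<le> a p"
    and sym: "\<And>p q. g p q = g q p"
    and off: "\<And>p q. p \<in> I \<Longrightarrow> q \<in> I \<Longrightarrow> p < q \<Longrightarrow> g p q \<le> a p * a q + b q"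
    and nonneg: "\<And>p. a p \<ge> 0" "\<And>p. b p \<ge> 0"
  shows "(\<Sum>p\<in>I. \<Sum>q\<in>I. g p q) \<le> (\<Sum>p\<in>I. a p)\<^sup>2 + (\<Sum>p\<in>I. a p) + 2 * (\<Sum>q\<in>I. real q * b q)"
proof -
  let ?d = "\<lambda>p q. if p = q then a p else 0"
  let ?u = "\<lambda>p q. if p < q then b q else 0"
  have "(\<Sum>p\<in>I. \<Sum>q\<in>I. g p q) \<le> (\<Sum>p\<in>I. \<Sum>q\<in>I. a p * a q + ?d p q + ?u p q + ?u q p)"
  proof (intro sum_mono)
    fix p q assume pq: "p \<in> I" "q \<in> I"
    consider "p = q" | "p < q" | "q < p" by linarith
    then show "g p q \<le> a p * a q + ?d p q + ?u p q + ?u q p"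
    proof cases
      case 1
      have "a q * a q \<ge> 0" using nonneg by simp
      then have "g q q \<le> a q * a q + a q" using diag[OF pq(2)] by linarith
      then show ?thesis using 1 by simp
    next
      case 2 with off[OF pq] show ?thesis by simp
    next
      case 3 with off[OF pq(2,1)] sym[of p q] show ?thesis by (simp add: mult.commute)
    qed
  qed
  also have "\<dots> = (\<Sum>p\<in>I. a p)\<^sup>2 + (\<Sum>p\<in>I. a p) + (\<Sum>p\<in>I. \<Sum>q\<in>I. ?u p q) + (\<Sum>p\<in>I. \<Sum>q\<in>I. ?u q p)"
    using fin by (simp add: sum.distrib power2_eq_square sum_product)
  also have "(\<Sum>p\<in>I. \<Sum>q\<in>I. ?u p q) = (\<Sum>p\<in>I. \<Sum>q\<in>I. ?u q p)" by (rule sum.swap)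
  also have "(\<Sum>p\<in>I. \<Sum>q\<in>I. ?u q p) \<le> (\<Sum>q\<in>I. real q * b q)"
  proof (rule sum_mono)
    fix q assume "q \<in> I"
    have "(\<Sum>p\<in>I. ?u p q) = (\<Sum>p\<in>{p\<in>I. p < q}. b q)"
      using fin by (simp only: sum.inter_filter)
    also have "\<dots> = real (card {p\<in>I. p < q}) * b q" by simp
    also have "\<dots> \<le> real q * b q"
    proof (intro mult_right_mono nonneg)
      have "card {p\<in>I. p < q} \<le> card {..<q}" by (intro card_mono) auto
      then show "real (card {p\<in>I. p < q}) \<le> real q" by simp
    qed
    finally show "(\<Sum>p\<in>I. ?u p q) \<le> real q * b q" .
  qed
  finally show ?thesis by simp
qed

section \<open>Almost every point of the torus\<close>

definition torus_measure :: "real measure" where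
  "torus_measure = restrict_space lborel torus"

lemma prob_space_torus_measure: "prob_space torus_measure"
  unfolding torus_measure_def by (rule prob_space_restrict_space) (auto simp: torus_def)

lemma sets_torus_measure: "A \<in> sets borel \<Longrightarrow> A \<subseteq> torus \<Longrightarrow> A \<in> sets torus_measure"
  by (auto simp: torus_measure_def sets_restrict_space_iff torus_def)

lemma measure_torus_measure: "A \<subseteq> torus \<Longrightarrow> measure torus_measure A = measure lborel A"
  unfolding torus_measure_def by (rule measure_restrict_space) (auto simp: torus_def)

text \<open>For finitely many primes \<open>p > N\<close> let \<open>s\<close> be the sum of
  \<open>2/p\<close>. Mean and variance of the number of events \<open>A p\<close> are of order
  \<open>s\<close>, so Chebyshev's inequality bounds \<open>prob B * s\<close> uniformly. As
  \<open>s\<close> can be made arbitrarily large, \<open>B\<close> is a null set.\<close>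

lemma AE_near_prime_fraction:
  "AE \<alpha> in torus_measure. \<exists>p>N. prime p \<and> \<alpha> \<in> near_fractions {1..<p} p"
proof -
  interpret prob_space torus_measure by (rule prob_space_torus_measure)
  define A where "A p = near_fractions {1..<p} p" for p
  have sub: "A p \<subseteq> torus" for p unfolding A_def by (rule near_fractions_subset_torus) simp
  have ev [measurable]: "A p \<in> events" for p
    by (rule sets_torus_measure[OF _ sub]) (simp add: A_def)
  have prob_A: "prob (A p) = 2 / real p - 2 / (real p)\<^sup>2" if "p \<ge> 2" for p
    using that measure_near_fractions[of "{1..<p}" p] measure_torus_measure[OF sub[of p]]
    by (simp add: A_def field_simps power2_eq_square)
  define B where "B = {\<alpha> \<in> space torus_measure. \<forall>p. p > N \<and> prime p \<longrightarrow> \<alpha> \<notin> A p}"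
  have [measurable]: "B \<in> events" unfolding B_def by measurable
  \<comment> \<open>The term at 0 vanishes because \<open>inverse 0 = 0\<close>.\<close>
  define K where "K = (\<Sum>n. inverse (real n ^ 2))"
  have sum_sq: "(\<Sum>p\<in>I. 2 / (real p)\<^sup>2) \<le> 2 * K" if "finite I" for I
  proof -
    have "(\<Sum>p\<in>I. inverse (real p ^ 2)) \<le> K"
      unfolding K_def by (intro sum_le_suminf inverse_power_summable that) auto
    then have "2 * (\<Sum>p\<in>I. inverse (real p ^ 2)) \<le> 2 * K" by simp
    then show ?thesis unfolding sum_distrib_left by (simp add: divide_inverse)
  qed
  have bound: "prob B * s \<le> 4 * (7 + 4 * K)"
    if I: "finite I" "\<And>p. p \<in> I \<Longrightarrow> prime p \<and> p > N" and s: "s = (\<Sum>p\<in>I. 2 / real p)" for I s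
  proof -
    define \<mu> where "\<mu> = (\<Sum>p\<in>I. prob (A p))"
    have ge2: "p \<ge> 2" if "p \<in> I" for p using I that prime_ge_2_nat by blast
    have s0: "s \<ge> 0" unfolding s by (intro sum_nonneg) auto
    have \<mu>: "\<mu> = s - (\<Sum>p\<in>I. 2 / (real p)\<^sup>2)"
      unfolding \<mu>_def s sum_subtractf[symmetric] by (intro sum.cong refl prob_A ge2)
    have \<mu>_half: "s / 2 \<le> \<mu>"
      unfolding \<mu>_def s sum_divide_distrib
    proof (rule sum_mono)
      fix p assume "p \<in> I"
      then show "2 / real p / 2 \<le> prob (A p)"
        using ge2[of p] by (simp add: prob_A field_simps power2_eq_square)
    qed
    have \<mu>_le: "\<mu> \<le> s" "s - 2 * K \<le> \<mu>" using sum_sq[OF I(1)] by (auto simp: \<mu> intro: sum_nonneg)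
    \<comment> \<open>The diagonal costs \<open>s\<close> and the overlap errors
      \<open>6/q\<^sup>2\<close> cost \<open>2 * (3 * s)\<close>, hence the total
      \<open>7 * s\<close>.\<close>
    have "(\<Sum>p\<in>I. \<Sum>q\<in>I. prob (A p \<inter> A q)) \<le> s\<^sup>2 + s + 2 * (\<Sum>q\<in>I. real q * (6 / (real q)\<^sup>2))"
      unfolding s
    proof (rule sum_diagonal_add_off_diagonal_le[OF I(1)])
      show "prob (A p \<inter> A p) \<le> 2 / real p" if "p \<in> I" for p
        using prob_A[OF ge2[OF that]] by simp
      show "prob (A p \<inter> A q) \<le> 2 / real p * (2 / real q) + 6 / (real q)\<^sup>2"
        if "p \<in> I" "q \<in> I" "p < q" for p q
      proof -
        have "coprime p q" using I that by (intro primes_coprime) auto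
        moreover have "prob (A p \<inter> A q) = measure lborel (A p \<inter> A q)"
          using sub by (intro measure_torus_measure) auto
        ultimately show ?thesis
          using measure_near_fractions_Int_le[of p q] that ge2[of p] by (simp add: A_def)
      qed
    qed (auto simp: Int_commute)
    also have "(\<Sum>q\<in>I. real q * (6 / (real q)\<^sup>2)) = 3 * s"
      unfolding s sum_distrib_left
    proof (intro sum.cong refl)
      fix q assume "q \<in> I"
      then show "real q * (6 / (real q)\<^sup>2) = 3 * (2 / real q)"
        using ge2[of q] by (simp add: power2_eq_square)
    qed
    finally have second: "(\<Sum>p\<in>I. \<Sum>q\<in>I. prob (A p \<inter> A q)) \<le> s\<^sup>2 + 7 * s" by simp
    have "prob B * (s / 2)\<^sup>2 \<le> prob {x \<in> space torus_measure. \<forall>i\<in>I. x \<notin> A i} * \<mu>\<^sup>2"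
    proof (intro mult_mono power_mono \<mu>_half)
      show "prob B \<le> prob {x \<in> space torus_measure. \<forall>i\<in>I. x \<notin> A i}"
        using I by (intro finite_measure_mono) (auto simp: B_def)
    qed (use s0 in auto)
    also have "\<dots> \<le> (\<Sum>p\<in>I. \<Sum>q\<in>I. prob (A p \<inter> A q)) - \<mu>\<^sup>2"
      unfolding \<mu>_def by (intro prob_none_le_second_moment I(1) ev)
    also have "\<dots> \<le> s\<^sup>2 + 7 * s - \<mu>\<^sup>2" using second by simp
    \<comment> \<open>The main terms cancel up to order \<open>s\<close>, because \<mu> differs from
      \<open>s\<close> by the bounded amount \<open>2 * K\<close> at most.\<close>
    also have "s\<^sup>2 - \<mu>\<^sup>2 \<le> 4 * K * s"
    proof -
      have "s\<^sup>2 - \<mu>\<^sup>2 = (s - \<mu>) * (s + \<mu>)" by (simp add: power2_eq_square algebra_simps)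
      also have "\<dots> \<le> (2 * K) * (2 * s)"
        using \<mu>_le \<mu>_half s0 by (intro mult_mono) auto
      finally show ?thesis by simp
    qed
    then have "s\<^sup>2 + 7 * s - \<mu>\<^sup>2 \<le> (7 + 4 * K) * s" by (simp add: algebra_simps)
    finally have main: "prob B * (s / 2)\<^sup>2 \<le> (7 + 4 * K) * s" .
    show ?thesis
    proof (cases "s = 0")
      case True
      have "K \<ge> 0" using sum_sq[of "{}"] by simp
      with True show ?thesis by simp
    next
      case False
      with s0 have "s > 0" by simp
      have "prob B * s * s = 4 * (prob B * (s / 2)\<^sup>2)" by (simp add: power2_eq_square)
      also have "\<dots> \<le> 4 * ((7 + 4 * K) * s)" by (intro mult_left_mono main) simp
      finally have "prob B * s * s \<le> 4 * (7 + 4 * K) * s" by (simp only: mult.assoc)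
      then show ?thesis using \<open>s > 0\<close> by (simp add: mult_le_cancel_right)
    qed
  qed
  have "prob B = 0"
  proof (rule ccontr)
    assume "prob B \<noteq> 0"
    then have pB: "prob B > 0" using measure_nonneg[of _ B] by (metis less_eq_real_def)
    let ?f = "\<lambda>n::nat. if prime n then 1 / real n else 0"
    have "summable (\<lambda>n. ?f (n + Suc N))"
    proof (rule summableI_nonneg_bounded)
      fix n
      let ?I = "{p \<in> {Suc N..<n + Suc N}. prime p}"
      have "(\<Sum>i<n. ?f (i + Suc N)) = (\<Sum>p\<in>{Suc N..<n + Suc N}. ?f p)"
        by (rule sum.reindex_bij_witness[of _ "\<lambda>p. p - Suc N" "\<lambda>i. i + Suc N"]) auto
      also have "\<dots> = (\<Sum>p\<in>?I. 1 / real p)" by (simp only: sum.inter_filter finite_atLeastLessThan)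
      also have "\<dots> \<le> (\<Sum>p\<in>?I. 2 / real p)" by (intro sum_mono divide_right_mono) auto
      also have "\<dots> \<le> 4 * (7 + 4 * K) / prob B"
      proof -
        have "prob B * (\<Sum>p\<in>?I. 2 / real p) \<le> 4 * (7 + 4 * K)"
          by (rule bound[OF _ _ refl]) auto
        then show ?thesis by (simp only: pos_le_divide_eq[OF pB] mult.commute)
      qed
      finally show "(\<Sum>i<n. ?f (i + Suc N)) \<le> 4 * (7 + 4 * K) / prob B" .
    qed auto
    then have "summable ?f" by (rule summable_iff_shift[of ?f "Suc N", THEN iffD1])
    with not_summable_inverse_primes show False ..
  qed
  then have "AE \<alpha> in torus_measure. \<alpha> \<notin> B"
    by (intro AE_not_in) (simp add: null_sets_def emeasure_eq_measure)
  with AE_space show ?thesis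
  proof eventually_elim
    case (elim \<alpha>)
    then show ?case by (auto simp: B_def A_def)
  qed
qed

text \<open>With at most \<open>m\<close> numerators the measures are at most
  \<open>2 m/p\<^sup>2\<close>, which is summable, so the first Borel-Cantelli lemma
  applies.\<close>

lemma AE_not_near_few_fractions:
  assumes C: "\<And>p. C p \<subseteq> {1..<p}" and card: "\<And>p. p > n0 \<Longrightarrow> prime p \<Longrightarrow> card (C p) \<le> m"
  shows "AE \<alpha> in torus_measure. \<forall>\<^sub>F p in sequentially. prime p \<longrightarrow> \<alpha> \<notin> near_fractions (C p) p"
proof -
  interpret prob_space torus_measure by (rule prob_space_torus_measure)
  define A where "A p = (if p > n0 \<and> prime p then near_fractions (C p) p else {})" for p
  have sub: "A p \<subseteq> torus" for p
    using near_fractions_subset_torus[OF C] by (auto simp: A_def)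
  have ev: "A p \<in> events" for p
    by (rule sets_torus_measure[OF _ sub]) (simp add: A_def)
  have "summable (\<lambda>p. prob (A p))"
  proof (rule summable_comparison_test')
    show "summable (\<lambda>p. 2 * real m * inverse (real p ^ 2))"
      by (intro summable_mult inverse_power_summable) auto
    fix p
    have "prob (A p) = measure lborel (A p)" by (rule measure_torus_measure[OF sub])
    also have "\<dots> \<le> 2 * real m * inverse (real p ^ 2)"
    proof (cases "p > n0 \<and> prime p")
      case True
      have "measure lborel (A p) = real (card (C p)) * (2 / (real p)\<^sup>2)"
        using True measure_near_fractions[OF C] by (simp add: A_def)
      also have "\<dots> \<le> real m * (2 / (real p)\<^sup>2)"
        using True card by (intro mult_right_mono) auto
      finally show ?thesis by (simp add: divide_inverse mult_ac)
    qed (auto simp: A_def)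
    finally show "norm (prob (A p)) \<le> 2 * real m * inverse (real p ^ 2)" by simp
  qed
  then have "AE \<alpha> in torus_measure. \<forall>\<^sub>F p in sequentially. \<alpha> \<in> space torus_measure - A p"
    by (intro borel_cantelli_AE1 ev) (auto simp: emeasure_eq_measure)
  then show ?thesis
  proof eventually_elim
    case (elim \<alpha>)
    then show ?case using eventually_gt_at_top[of n0]
      by eventually_elim (auto simp: A_def)
  qed
qed

lemma AE_near_fraction_with_good_numerator:
  fixes \<psi> :: "int poly"
  assumes "degree \<psi> > 0"
  shows "AE \<alpha> in torus_measure. \<forall>N. \<exists>p>N.
           \<alpha> \<in> near_fractions {c \<in> {1..<p}. good_numerator \<psi> (int p) (int c)} p"
proof -
  define C where "C p = {c \<in> {1..<p}. \<not> good_numerator \<psi> (int p) (int c)}" for p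
  \<comment> \<open>A prime beyond \<open>n0\<close> exceeds the degree and cannot divide the
    nonzero leading coefficient.\<close>
  define n0 where "n0 = max (degree \<psi>) (nat \<bar>lead_coeff \<psi>\<bar>)"
  have "AE \<alpha> in torus_measure. \<forall>\<^sub>F p in sequentially. prime p \<longrightarrow> \<alpha> \<notin> near_fractions (C p) p"
  proof (rule AE_not_near_few_fractions)
    show "C p \<subseteq> {1..<p}" for p by (auto simp: C_def)
    fix p assume p: "p > n0" "prime p"
    have "lead_coeff \<psi> \<noteq> 0" using assms by auto
    then have "\<not> int p dvd lead_coeff \<psi>" using p(1) dvd_imp_le_int[of "lead_coeff \<psi>" "int p"]
      by (auto simp: n0_def)
    then have "card {c \<in> {0..<int p}. \<not> good_numerator \<psi> (int p) c} \<le> 4 * (degree \<psi>)\<^sup>2"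
      using p assms by (intro card_not_good_numerator_le) (auto simp: n0_def)
    moreover have "card (C p) \<le> card {c \<in> {0..<int p}. \<not> good_numerator \<psi> (int p) c}"
    proof (rule card_inj_on_le)
      show "inj_on int (C p)" by simp
      show "finite {c \<in> {0..<int p}. \<not> good_numerator \<psi> (int p) c}"
        by (rule finite_subset[of _ "{0..<int p}"]) auto
    qed (auto simp: C_def)
    ultimately show "card (C p) \<le> 4 * (degree \<psi>)\<^sup>2" by simp
  qed
  moreover have "AE \<alpha> in torus_measure. \<forall>N. \<exists>p>N. prime p \<and> \<alpha> \<in> near_fractions {1..<p} p"
    unfolding AE_all_countable by (intro allI AE_near_prime_fraction)
  ultimately show ?thesis
  \<comment> \<open>Infinitely many primes have some fraction near \<alpha>, and from
    \<open>N1\<close> on none of these fractions is exceptional, so the numerators are good.\<close>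
  proof eventually_elim
    case (elim \<alpha>)
    from elim(1) obtain N1 where N1: "prime p \<Longrightarrow> \<alpha> \<notin> near_fractions (C p) p" if "p \<ge> N1" for p
      unfolding eventually_sequentially by blast
    show ?case
    proof
      fix N
      obtain p where p: "p > max N N1" "prime p" "\<alpha> \<in> near_fractions {1..<p} p"
        using elim(2) by blast
      have "\<alpha> \<notin> near_fractions (C p) p" using N1[of p] p by simp
      then have "\<alpha> \<in> near_fractions {c \<in> {1..<p}. good_numerator \<psi> (int p) (int c)} p"
        using p(3) unfolding near_fractions_def C_def by blast
      with p(1) show "\<exists>p>N. \<alpha> \<in> near_fractions {c \<in> {1..<p}. good_numerator \<psi> (int p) (int c)} p"
        by auto
    qed
  qed
qed

section \<open>The set of full measure and the lower bound for the supremum\<close>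

theorem theorem1p1:
  fixes \<phi> :: "int poly" and k :: nat
  assumes "degree \<phi> = k" and "k \<ge> 2"
  shows "\<exists>\<C> \<subseteq> torus. \<C> \<in> sets lebesgue \<and> emeasure lebesgue \<C> = emeasure lebesgue torus \<and>
           (\<forall>\<tau>::real. \<tau> > 0 \<longrightarrow>
              (\<exists>C::real. C > 0 \<and>
                 (\<forall>\<alpha>2\<in>\<C>. \<forall>P0::real. \<exists>P::real. P \<ge> P0 \<and> P \<ge> 1 \<and>
                    (SUP \<alpha>1\<in>torus. norm (expsum \<phi> P \<alpha>1 \<alpha>2)) \<ge> C * P powr (3/4 - \<tau>))))"
proof -
  define \<psi> where "\<psi> = \<phi> + [:0, 1:]"
  define G where "G p = {c \<in> {1..<p}. good_numerator \<psi> (int p) (int c)}" for p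
  \<comment> \<open>The set depends on \<phi> alone, so one set serves all \<tau>.\<close>
  define \<C> where "\<C> = {\<alpha> \<in> torus. \<forall>N. \<exists>p>N. \<alpha> \<in> near_fractions (G p) p}"
  \<comment> \<open>Adding X leaves the degree unchanged because \<open>k \<ge> 2\<close>.\<close>
  have "degree \<psi> = k"
    unfolding \<psi>_def using assms by (subst degree_add_eq_left) auto
  then have AE: "AE \<alpha> in torus_measure. \<forall>N. \<exists>p>N. \<alpha> \<in> near_fractions (G p) p"
    using assms unfolding G_def by (intro AE_near_fraction_with_good_numerator) simp
  have torus_borel [measurable]: "torus \<in> sets borel" by (simp add: torus_def)
  have borel: "\<C> \<in> sets borel" unfolding \<C>_def by measurable
  have sub: "\<C> \<subseteq> torus" by (auto simp: \<C>_def)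
  have "emeasure torus_measure \<C> = emeasure torus_measure torus"
  proof (rule emeasure_eq_AE)
    show "AE \<alpha> in torus_measure. \<alpha> \<in> \<C> \<longleftrightarrow> \<alpha> \<in> torus"
      using AE by eventually_elim (auto simp: \<C>_def)
  qed (use borel sub torus_borel in \<open>auto intro: sets_torus_measure\<close>)
  then have "emeasure lborel \<C> = emeasure lborel torus"
    using sub by (simp add: torus_measure_def emeasure_restrict_space)
  then have meas: "emeasure lebesgue \<C> = emeasure lebesgue torus"
    using borel torus_borel by simp
  have large: "\<exists>P. P \<ge> P0 \<and> P \<ge> 1 \<and>
      (SUP \<alpha>1\<in>torus. norm (expsum \<phi> P \<alpha>1 \<alpha>)) \<ge> 1/128 * P powr (3/4 - \<tau>)"
    if \<alpha>: "\<alpha> \<in> \<C>" and \<tau>: "\<tau> > 0" for \<alpha> \<tau> P0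
  proof -
    obtain p where p: "p > max 40000 (nat \<lceil>P0\<rceil>)" and near: "\<alpha> \<in> near_fractions (G p) p"
      using \<alpha> unfolding \<C>_def by blast
    obtain c where c: "good_numerator \<psi> (int p) (int c)" "\<bar>real c / real p - \<alpha>\<bar> < 1 / (real p)\<^sup>2"
      using near by (auto simp: near_fractions_def G_def dist_real_def)
    define P where "P = real_of_int (int p * (int p div 16))"
    have "\<exists>\<alpha>1\<in>torus. norm (expsum \<phi> P \<alpha>1 \<alpha>) \<ge> 1/128 * P powr (3/4)"
      unfolding P_def using p c
      by (intro expsum_large_near_good_numerator[of "int p" \<phi> "int c" \<alpha>])
        (simp_all add: \<psi>_def abs_minus_commute)
    then obtain \<alpha>1 where \<alpha>1: "\<alpha>1 \<in> torus" "norm (expsum \<phi> P \<alpha>1 \<alpha>) \<ge> 1/128 * P powr (3/4)"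
      by auto
    have P_ge: "P \<ge> real p"
    proof -
      have "int p * 1 \<le> int p * (int p div 16)" using p by (intro mult_left_mono) auto
      then show ?thesis unfolding P_def by linarith
    qed
    \<comment> \<open>The bound holds with exponent 3/4 itself and a constant free of \<phi> and
      \<tau>; as \<open>P \<ge> 1\<close>, lowering the exponent by \<tau> only weakens it.\<close>
    have "1/128 * P powr (3/4 - \<tau>) \<le> 1/128 * P powr (3/4)"
      using P_ge p \<tau> by (intro mult_left_mono powr_mono) auto
    also have "\<dots> \<le> norm (expsum \<phi> P \<alpha>1 \<alpha>)" by (rule \<alpha>1)
    also have "\<dots> \<le> (SUP \<alpha>1\<in>torus. norm (expsum \<phi> P \<alpha>1 \<alpha>))"
      by (intro cSUP_upper expsum_bdd_above \<alpha>1)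
    finally show ?thesis using P_ge p by (intro exI[of _ P]) (auto; linarith)
  qed
  have "\<forall>\<tau>::real. \<tau> > 0 \<longrightarrow> (\<exists>C::real. C > 0 \<and>
      (\<forall>\<alpha>2\<in>\<C>. \<forall>P0::real. \<exists>P::real. P \<ge> P0 \<and> P \<ge> 1 \<and>
        (SUP \<alpha>1\<in>torus. norm (expsum \<phi> P \<alpha>1 \<alpha>2)) \<ge> C * P powr (3/4 - \<tau>)))"
  proof (intro allI impI exI[of _ "1/128::real"] conjI)
    fix \<tau> :: real assume "\<tau> > 0"
    then show "\<forall>\<alpha>2\<in>\<C>. \<forall>P0::real. \<exists>P::real. P \<ge> P0 \<and> P \<ge> 1 \<and>
        (SUP \<alpha>1\<in>torus. norm (expsum \<phi> P \<alpha>1 \<alpha>2)) \<ge> 1/128 * P powr (3/4 - \<tau>)"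
      by (intro ballI allI large)
  qed simp
  moreover have "\<C> \<in> sets lebesgue" using borel by simp
  ultimately show ?thesis using sub meas by blast
qed

end
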